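(* Let $k,M\ge1$ be integers, and consider the channel with parameters $(k,M,\xi,\gamma)$ where $\xi=1$ and $1\le\gamma<\infty$. Let $\mathcal{C}^*_{1,\infty}=\{\mathbf{x}\in\mathcal{X}:\gcd(x_1,\ldots,x_k)=1\}$. Then $$\mathcal{C}^*_{1,\gamma}=\bigcup_{\mathbf{x}\in\mathcal{C}^*_{1,\infty}}\mathcal{L}^{\gamma}_{\mathbf{x}}$$ is an optimal zero-error code for this channel. That is, any two distinct elements of $\mathcal{C}^*_{1,\gamma}$ are distinguishable, and every zero-error code $\mathcal{C}\subseteq\mathcal{X}$ satisfies $|\mathcal{C}|\le|\mathcal{C}^*_{1,\gamma}|$.
   Context: Input vectors: for positive integers $k,M$, let $\mathcal{X}$ be the set of vectors $\mathbf{x}=(x_1,\ldots,x_k)$ with $x_i\in\{1,\ldots,M\}$ and $\sum_{i=1}^k x_i\le M$. Channel: fix real numbers $0<a\le b<\infty$ (jitter interval $[a,b]$) with $\xi=b/a$, and a clock drift interval $I=[T_1,T_2]$ with $0<T_1\le T_2<\infty$ and $\gamma=T_2/T_1$. When $\mathbf{x}$ is sent, the output is $Y_i=TZ_ix_i$ for $i=1,\ldots,k$, where $T\in I$ and $Z_1,\ldots,Z_k\in[a,b]$ are arbitrary unknown reals. The case $\xi=1$ means no jitter ($a=b$). Two vectors $\mathbf{x},\mathbf{x}'\in\mathcal{X}$ are indistinguishable if there exist $T,T'\in I$ and $Z_1,\ldots,Z_k,Z_1',\ldots,Z_k'\in[a,b]$ such that $TZ_ix_i=T'Z_i'x_i'$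 for all $i=1,\ldots,k$. Otherwise they are distinguishable. Distinguishability depends on the intervals only through $\xi$ and $\gamma$. A zero-error code is a set $\mathcal{C}\subseteq\mathcal{X}$ any two distinct elements of which are distinguishable. An optimal zero-error code is a zero-error code of maximum cardinality. The set $\mathcal{L}^{\gamma}_{\mathbf{x}}$: for real $\gamma\ge1$, define integers $d_1=1$ and $d_i=\lfloor\gamma d_{i-1}+1\rfloor$ for $i\ge2$ (so $d_i$ is the smallest integer with $d_i/d_{i-1}>\gamma$). For $\mathbf{x}\in\mathcal{X}$ with $\gcd(x_1,\ldots,x_k)=1$, set $\mathcal{L}^\gamma_{\mathbf{x}}=\{d_i\mathbf{x}: i\ge1,\ d_i\mathbf{x}\in\mathcal{X}\}$, where $d\mathbf{x}=(dx_1,\ldots,dx_k)$. (Equivalently, start with $d_1\mathbf{x}=\mathbf{x}$ and add $d_2\mathbf{x},d_3\mathbf{x},\ldots$ successively, stopping at the first multiple not in $\mathcal{X}$.) *)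

theory Defs
  imports Complex_Main
begin

text \<open>Vectors of length \<open>k\<close> are lists; the coordinate \<open>x\<^sub>i\<close> is \<open>x ! (i - 1)\<close>.\<close>

definition input_vectors :: "nat \<Rightarrow> nat \<Rightarrow> nat list set" where
  "input_vectors k M = {x. length x = k \<and> set x \<subseteq> {1..M} \<and> sum_list x \<le> M}"

text \<open>All codes are subsets of \<^term>\<open>input_vectors k M\<close>, so comparing them by \<^const>\<open>card\<close>
  is meaningful.\<close>

lemma finite_input_vectors: "finite (input_vectors k M)"
  by (rule finite_subset[OF _ finite_lists_length_eq[of "{1..M}" k]])
    (auto simp: input_vectors_def)

text \<open>Channel with jitter interval \<open>[a, b]\<close> and clock drift interval \<open>[T1, T2]\<close>.\<close>

definition indistinguishable ::
  "nat \<Rightarrow> real \<Rightarrow> real \<Rightarrow> real \<Rightarrow> real \<Rightarrow> nat list \<Rightarrow> nat list \<Rightarrow> bool" where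
  "indistinguishable k a b T1 T2 x x' \<longleftrightarrow>
     (\<exists>T\<in>{T1..T2}. \<exists>T'\<in>{T1..T2}. \<exists>Z Z' :: nat \<Rightarrow> real.
        (\<forall>i<k. Z i \<in> {a..b} \<and> Z' i \<in> {a..b}) \<and>
        (\<forall>i<k. T * Z i * real (x ! i) = T' * Z' i * real (x' ! i)))"

abbreviation distinguishable ::
  "nat \<Rightarrow> real \<Rightarrow> real \<Rightarrow> real \<Rightarrow> real \<Rightarrow> nat list \<Rightarrow> nat list \<Rightarrow> bool" where
  "distinguishable k a b T1 T2 x x' \<equiv> \<not> indistinguishable k a b T1 T2 x x'"

definition zero_error_code ::
  "nat \<Rightarrow> nat \<Rightarrow> real \<Rightarrow> real \<Rightarrow> real \<Rightarrow> real \<Rightarrow> nat list set \<Rightarrow> bool" where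
  "zero_error_code k M a b T1 T2 C \<longleftrightarrow>
     C \<subseteq> input_vectors k M \<and> pairwise (distinguishable k a b T1 T2) C"

definition optimal_zero_error_code ::
  "nat \<Rightarrow> nat \<Rightarrow> real \<Rightarrow> real \<Rightarrow> real \<Rightarrow> real \<Rightarrow> nat list set \<Rightarrow> bool" where
  "optimal_zero_error_code k M a b T1 T2 C \<longleftrightarrow>
     zero_error_code k M a b T1 T2 C \<and>
     (\<forall>C'. zero_error_code k M a b T1 T2 C' \<longrightarrow> card C' \<le> card C)"

text \<open>The sequence is indexed from 0: \<open>dseq \<gamma> i\<close> is \<open>d\<^bsub>i+1\<^esub>\<close>.  For \<open>\<gamma> \<ge> 0\<close> the floor is
  positive, so \<^const>\<open>nat\<close> loses nothing.\<close>

primrec dseq :: "real \<Rightarrow> nat \<Rightarrow> nat" where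
  "dseq \<gamma> 0 = 1"
| "dseq \<gamma> (Suc i) = nat \<lfloor>\<gamma> * real (dseq \<gamma> i) + 1\<rfloor>"

definition scale_vec :: "nat \<Rightarrow> nat list \<Rightarrow> nat list" where
  "scale_vec d x = map (\<lambda>n. d * n) x"

definition multiples_code :: "nat \<Rightarrow> nat \<Rightarrow> real \<Rightarrow> nat list \<Rightarrow> nat list set" where
  "multiples_code k M \<gamma> x =
     {scale_vec (dseq \<gamma> i) x | i. scale_vec (dseq \<gamma> i) x \<in> input_vectors k M}"

text \<open>The codes \<open>C\<^sup>*\<^bsub>1,\<infinity>\<^esub>\<close> and \<open>C\<^sup>*\<^bsub>1,\<gamma>\<^esub>\<close> for finite \<open>\<gamma>\<close>.\<close>

definition Cstar_inf :: "nat \<Rightarrow> nat \<Rightarrow> nat list set" where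
  "Cstar_inf k M = {x \<in> input_vectors k M. Gcd (set x) = 1}"

definition Cstar :: "nat \<Rightarrow> nat \<Rightarrow> real \<Rightarrow> nat list set" where
  "Cstar k M \<gamma> = (\<Union>x\<in>Cstar_inf k M. multiples_code k M \<gamma> x)"

end

theory Submission
  imports Defs
begin

text \<open>Without jitter, two vectors are indistinguishable iff they are positive multiples \<open>m p\<close>,
  \<open>n p\<close> of the same primitive vector \<open>p\<close> with ratio \<open>m / n\<close> in \<open>[1 / \<gamma>, \<gamma>]\<close>.  Hence distinct
  members of the sequence \<open>d\<^sub>i\<close> give distinguishable multiples.  Conversely, sending \<open>n p\<close> to
  \<open>d\<^sub>i p\<close>, where \<open>d\<^sub>i\<close> is the largest member of the sequence that is at most \<open>n\<close>, is injective
  on every zero-error code, because \<open>d\<^sub>i \<le> n < d\<^bsub>i+1\<^esub>\<close> forces \<open>n \<le> \<gamma> d\<^sub>i\<close>.\<close>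

text \<open>With both jitter endpoints equal to \<open>a\<close>, every \<open>Z i\<close> and
  \<open>Z' i\<close> is \<open>a\<close>, and this positive factor cancels. Only the two drift
  values remain.\<close>

lemma indistinguishable_no_jitter:
  assumes "0 < a"
  shows "indistinguishable k a a T1 T2 x y \<longleftrightarrow>
    (\<exists>T\<in>{T1..T2}. \<exists>T'\<in>{T1..T2}. \<forall>i<k. T * real (x ! i) = T' * real (y ! i))"
proof
  assume "indistinguishable k a a T1 T2 x y"
  then obtain T T' Z Z' where T: "T \<in> {T1..T2}" "T' \<in> {T1..T2}"
    and Z: "\<forall>i<k. Z i \<in> {a..a} \<and> Z' i \<in> {a..a}"
    and eq: "\<forall>i<k. T * Z i * real (x ! i) = T' * Z' i * real (y ! i)"
    unfolding indistinguishable_def by blast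
  have "T * real (x ! i) = T' * real (y ! i)" if "i < k" for i
  proof -
    have "Z i = a" "Z' i = a"
      using Z that by auto
    moreover have "T * Z i * real (x ! i) = T' * Z' i * real (y ! i)"
      using eq that by blast
    ultimately have "a * (T * real (x ! i)) = a * (T' * real (y ! i))"
      by (simp add: ac_simps)
    then show ?thesis
      using assms by simp
  qed
  then show "\<exists>T\<in>{T1..T2}. \<exists>T'\<in>{T1..T2}. \<forall>i<k. T * real (x ! i) = T' * real (y ! i)"
    using T by blast
next
  assume "\<exists>T\<in>{T1..T2}. \<exists>T'\<in>{T1..T2}. \<forall>i<k. T * real (x ! i) = T' * real (y ! i)"
  then obtain T T' where T: "T \<in> {T1..T2}" "T' \<in> {T1..T2}"
    and eq: "\<forall>i<k. T * real (x ! i) = T' * real (y ! i)"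
    by blast
  have "T * a * real (x ! i) = T' * a * real (y ! i)" if "i < k" for i
  proof -
    have "a * (T * real (x ! i)) = a * (T' * real (y ! i))"
      using eq that by simp
    then show ?thesis
      by (simp only: ac_simps)
  qed
  then show "indistinguishable k a a T1 T2 x y"
    unfolding indistinguishable_def using T
    by (intro bexI[of _ T] bexI[of _ T'] exI[of _ "\<lambda>_. a"]) auto
qed

lemma indistinguishable_sym:
  "indistinguishable k a b T1 T2 x y \<Longrightarrow> indistinguishable k a b T1 T2 y x"
  unfolding indistinguishable_def by metis

section \<open>Scalar multiples and primitive vectors\<close>

lemma length_scale_vec [simp]: "length (scale_vec d x) = length x"
  by (simp add: scale_vec_def)

lemma nth_scale_vec [simp]: "i < length x \<Longrightarrow> scale_vec d x ! i = d * x ! i"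
  by (simp add: scale_vec_def)

lemma Gcd_scale_vec: "Gcd (set (scale_vec d x)) = d * Gcd (set x)"
  by (simp add: scale_vec_def Gcd_mult)

lemma scale_vec_Gcd_div: "scale_vec (Gcd (set x)) (map (\<lambda>n. n div Gcd (set x)) x) = x"
  by (auto simp: scale_vec_def intro!: map_idI)

text \<open>Used to step down along a ray: to the primitive vector itself (factor 1) and to the
  multiple by a member of \<open>dseq\<close>. Positivity of \<open>d\<close> keeps every entry at
  least 1.\<close>

lemma scale_vec_in_input_vectors_mono:
  assumes "scale_vec n x \<in> input_vectors k M" and "0 < d" and "d \<le> n"
  shows "scale_vec d x \<in> input_vectors k M"
proof -
  have le: "sum_list (scale_vec d x) \<le> sum_list (scale_vec n x)"
    unfolding scale_vec_def using assms(3) by (intro sum_list_mono mult_right_mono) auto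
  have "d * m \<in> {1..M}" if "m \<in> set x" for m
  proof -
    have "n * m \<in> {1..M}"
      using assms(1) that by (auto simp: input_vectors_def scale_vec_def)
    moreover have "d * m \<le> n * m"
      using assms(3) by simp
    moreover have "1 \<le> d * m"
      using \<open>n * m \<in> {1..M}\<close> assms(2) by (cases m) auto
    ultimately show ?thesis
      unfolding atLeastAtMost_iff by linarith
  qed
  then show ?thesis
    using assms(1) le by (auto simp: input_vectors_def scale_vec_def)
qed

lemma primitive_decomposition:
  assumes "x \<in> input_vectors k M" and "k \<ge> 1"
  obtains p n where "p \<in> Cstar_inf k M" "0 < n" "x = scale_vec n p"
proof -
  let ?n = "Gcd (set x)" and ?p = "map (\<lambda>n. n div Gcd (set x)) x"
  have x: "x = scale_vec ?n ?p"
    by (simp only: scale_vec_Gcd_div)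
  \<comment> \<open>The empty list would have gcd 0; \<open>k \<ge> 1\<close> supplies a positive
    entry, so the division by the gcd is sound.\<close>
  have "x ! 0 \<in> set x"
    using assms by (auto simp: input_vectors_def)
  moreover have "0 < x ! 0"
    using assms(1) calculation by (fastforce simp: input_vectors_def)
  ultimately have "set x \<subseteq> {0} \<Longrightarrow> False"
    by auto
  then have pos: "0 < ?n"
    using Gcd_0_iff by blast
  have "?n * Gcd (set ?p) = ?n"
    by (metis Gcd_scale_vec x)
  then have "Gcd (set ?p) = 1"
    using pos by (metis mult_cancel1 mult.right_neutral less_numeral_extra(3))
  moreover have "?p \<in> input_vectors k M"
    using scale_vec_in_input_vectors_mono[of ?n ?p k M 1] pos assms(1) x
    by (simp add: scale_vec_def)
  ultimately have "?p \<in> Cstar_inf k M"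
    by (simp add: Cstar_inf_def)
  then show ?thesis
    using that pos x by blast
qed

lemma primitive_proportional_eq:
  fixes p q :: "nat list" and s t :: real
  assumes "length p = length q" and "Gcd (set p) = 1" and "Gcd (set q) = 1" and "s > 0"
    and scaled: "\<And>i. i < length p \<Longrightarrow> s * real (p ! i) = t * real (q ! i)"
  shows "p = q"
proof (rule nth_equalityI)
  fix i assume i: "i < length p"
  have "q ! i * p ! j = p ! i * q ! j" if j: "j < length p" for j
  proof -
    have "s * (real (q ! i) * real (p ! j)) = t * real (q ! j) * real (q ! i)"
      using scaled[OF j] by (simp add: algebra_simps)
    also have "\<dots> = s * (real (p ! i) * real (q ! j))"
      using scaled[OF i] by (simp add: algebra_simps)
    finally have "real (q ! i * p ! j) = real (p ! i * q ! j)"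
      using \<open>s > 0\<close> by simp
    then show ?thesis
      by (simp only: of_nat_eq_iff)
  qed
  \<comment> \<open>The real factors are now eliminated; comparing the gcds of both sides, with
    \<open>p\<close> and \<open>q\<close> primitive, leaves \<open>q ! i = p ! i\<close>.\<close>
  then have "scale_vec (q ! i) p = scale_vec (p ! i) q"
    using assms(1) by (intro nth_equalityI) auto
  then have "q ! i * Gcd (set p) = p ! i * Gcd (set q)"
    by (metis Gcd_scale_vec)
  then show "p ! i = q ! i"
    using assms by simp
qed (fact assms(1))

section \<open>Growth of the sequence \<open>dseq\<close>\<close>

lemma dseq_Suc_gt:
  assumes "0 \<le> \<gamma>"
  shows "\<gamma> * real (dseq \<gamma> i) < real (dseq \<gamma> (Suc i))"
proof -
  have "0 \<le> \<gamma> * real (dseq \<gamma> i)"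
    using assms by simp
  then have "0 \<le> \<lfloor>\<gamma> * real (dseq \<gamma> i) + 1\<rfloor>"
    by linarith
  then show ?thesis
    unfolding dseq.simps by linarith
qed

text \<open>An integer below the floor of \<open>u + 1\<close> is at most \<open>u\<close>. Together
  with \<open>dseq_Suc_gt\<close> this makes each member the least integer exceeding \<gamma> times
  its predecessor.\<close>

lemma le_mult_dseq_if_less_dseq_Suc:
  assumes "n < dseq \<gamma> (Suc i)"
  shows "real n \<le> \<gamma> * real (dseq \<gamma> i)"
  using assms by simp linarith

lemma strict_mono_dseq:
  assumes "1 \<le> \<gamma>"
  shows "strict_mono (dseq \<gamma>)"
proof (rule strict_mono_Suc_iff[THEN iffD2], rule allI)
  fix i
  have "real (dseq \<gamma> i) \<le> \<gamma> * real (dseq \<gamma> i)"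
    using assms by (simp add: mult_le_cancel_right1)
  also have "\<dots> < real (dseq \<gamma> (Suc i))"
    using assms by (intro dseq_Suc_gt) simp
  finally show "dseq \<gamma> i < dseq \<gamma> (Suc i)"
    by simp
qed

lemma dseq_pos:
  assumes "1 \<le> \<gamma>"
  shows "0 < dseq \<gamma> i"
  using strict_mono_leD[OF strict_mono_dseq[OF assms], of 0 i] by simp

lemma mult_dseq_less:
  assumes "1 \<le> \<gamma>" and "i < j"
  shows "\<gamma> * real (dseq \<gamma> i) < real (dseq \<gamma> j)"
proof -
  have "\<gamma> * real (dseq \<gamma> i) < real (dseq \<gamma> (Suc i))"
    using assms by (intro dseq_Suc_gt) simp
  also have "\<dots> \<le> real (dseq \<gamma> j)"
    using strict_mono_leD[OF strict_mono_dseq[OF assms(1)], of "Suc i" j] assms(2) by simp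
  finally show ?thesis .
qed

text \<open>Strict growth in the naturals gives a term above \<open>n\<close>. The least index of
  such a term is not 0, since \<open>dseq \<gamma> 0 = 1\<close>, so it is the successor of the
  desired \<open>i\<close>.\<close>

lemma dseq_bracket:
  assumes "1 \<le> \<gamma>" and "0 < n"
  obtains i where "dseq \<gamma> i \<le> n" "n < dseq \<gamma> (Suc i)"
proof -
  have "n < dseq \<gamma> (Suc n)"
    using strict_mono_imp_increasing[OF strict_mono_dseq[OF assms(1)], of "Suc n"] by linarith
  then have "\<exists>i. n < dseq \<gamma> i" ..
  moreover have "\<not> n < dseq \<gamma> 0"
    using assms(2) by simp
  ultimately show ?thesis
    using that ex_least_nat_less[of "\<lambda>i. n < dseq \<gamma> i"] by (metis le_refl not_less)
qed

section \<open>Distinguishability along rays\<close>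

lemma indistinguishable_scale_vec:
  assumes "0 < a" and "0 < T1" and "length p = k" and "0 < m" and "m \<le> n"
    and "real n \<le> T2 / T1 * real m"
  shows "indistinguishable k a a T1 T2 (scale_vec m p) (scale_vec n p)"
proof -
  \<comment> \<open>The longer vector is sent at the slowest admissible drift \<open>T1\<close>; the
    shorter one must be stretched by \<open>n / m\<close>, which the ratio bound keeps within
    \<open>T2\<close>.\<close>
  let ?T = "T1 * real n / real m"
  have "?T \<le> T2"
    using assms by (simp add: field_simps)
  moreover have "T1 \<le> ?T"
    using assms by (simp add: field_simps)
  moreover have "T1 \<le> T2"
    using calculation by linarith
  moreover have "\<forall>i<k. ?T * real (scale_vec m p ! i) = T1 * real (scale_vec n p ! i)"
    using assms by simp
  ultimately show ?thesis
    unfolding indistinguishable_no_jitter[OF assms(1)]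
    by (intro bexI[of _ ?T] bexI[of _ T1]) auto
qed

text \<open>Primitivity forces equal rays. On one ray, a later member of \<open>dseq\<close> exceeds
  an earlier one by more than the drift ratio can compensate. The one-sided conclusion
  \<open>j \<le> i\<close> becomes equality by symmetry.\<close>

lemma indistinguishable_dseqD:
  assumes "0 < a" and "0 < T1" and "1 \<le> T2 / T1" and "k \<ge> 1"
    and p: "p \<in> Cstar_inf k M" and q: "q \<in> Cstar_inf k M"
    and ind: "indistinguishable k a a T1 T2
      (scale_vec (dseq (T2 / T1) i) p) (scale_vec (dseq (T2 / T1) j) q)"
  shows "p = q \<and> j \<le> i"
proof -
  let ?d = "dseq (T2 / T1)"
  have len: "length p = k" "length q = k"
    using p q by (auto simp: Cstar_inf_def input_vectors_def)
  obtain T T' where T: "T \<in> {T1..T2}" "T' \<in> {T1..T2}"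
    and eq: "\<forall>l<k. T * real (scale_vec (?d i) p ! l) = T' * real (scale_vec (?d j) q ! l)"
    using ind unfolding indistinguishable_no_jitter[OF assms(1)] by blast
  have eq': "T * real (?d i) * real (p ! l) = T' * real (?d j) * real (q ! l)" if "l < k" for l
    using eq that len by (simp add: mult.assoc)
  have pos: "0 < ?d i"
    using assms(3) by (rule dseq_pos)
  have pq: "p = q"
  proof (rule primitive_proportional_eq)
    show "0 < T * real (?d i)"
      using T assms(2) pos by simp
  qed (use len p q eq' in \<open>auto simp: Cstar_inf_def\<close>)
  \<comment> \<open>A positive coordinate to cancel turns the vector equation into one between the
    two scaling factors.\<close>
  have "0 < p ! 0"
    using p len assms(4) nth_mem[of 0 p] by (fastforce simp: Cstar_inf_def input_vectors_def)
  then have Td: "T * real (?d i) = T' * real (?d j)"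
    using eq'[of 0] assms(4) pq by simp
  have "j \<le> i"
  proof (rule ccontr)
    assume "\<not> j \<le> i"
    then have less: "T2 / T1 * real (?d i) < real (?d j)"
      using assms(3) by (intro mult_dseq_less) auto
    have "T * real (?d i) \<le> T2 * real (?d i)"
      using T by (intro mult_right_mono) auto
    also have "\<dots> < T1 * real (?d j)"
      using less assms(2) by (simp add: field_simps)
    also have "\<dots> \<le> T' * real (?d j)"
      using T by (intro mult_right_mono) auto
    finally show False
      using Td by simp
  qed
  then show ?thesis
    using pq by simp
qed

lemma zero_error_code_Cstar:
  assumes "0 < a" and "0 < T1" and "1 \<le> T2 / T1" and "k \<ge> 1"
  shows "zero_error_code k M a a T1 T2 (Cstar k M (T2 / T1))"
  unfolding zero_error_code_def
proof (intro conjI pairwiseI notI)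
  show "Cstar k M (T2 / T1) \<subseteq> input_vectors k M"
    by (auto simp: Cstar_def multiples_code_def)
next
  fix x y
  assume "x \<in> Cstar k M (T2 / T1)" "y \<in> Cstar k M (T2 / T1)" "x \<noteq> y"
    and ind: "indistinguishable k a a T1 T2 x y"
  then obtain p i q j where p: "p \<in> Cstar_inf k M" "x = scale_vec (dseq (T2 / T1) i) p"
    and q: "q \<in> Cstar_inf k M" "y = scale_vec (dseq (T2 / T1) j) q"
    by (auto simp: Cstar_def multiples_code_def)
  have "p = q \<and> j \<le> i"
    using ind p q by (intro indistinguishable_dseqD[OF assms]) auto
  moreover have "q = p \<and> i \<le> j"
    using indistinguishable_sym[OF ind] p q by (intro indistinguishable_dseqD[OF assms]) auto
  ultimately show False
    using \<open>x \<noteq> y\<close> p q by auto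
qed

text \<open>A relation rather than a function, so that the primitive vector, the factor and the
  index stay existential; a rounding map is chosen from it in
  \<open>zero_error_code_card_le\<close>.\<close>

definition rounds_to :: "nat \<Rightarrow> nat \<Rightarrow> real \<Rightarrow> nat list \<Rightarrow> nat list \<Rightarrow> bool" where
  "rounds_to k M \<gamma> x y \<longleftrightarrow> (\<exists>p\<in>Cstar_inf k M. \<exists>n i. x = scale_vec n p \<and>
     y = scale_vec (dseq \<gamma> i) p \<and> dseq \<gamma> i \<le> n \<and> n < dseq \<gamma> (Suc i))"

lemma rounds_to_exists:
  assumes "1 \<le> \<gamma>" and "k \<ge> 1" and "x \<in> input_vectors k M"
  shows "\<exists>y\<in>Cstar k M \<gamma>. rounds_to k M \<gamma> x y"
proof -
  obtain p n where p: "p \<in> Cstar_inf k M" "0 < n" "x = scale_vec n p"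
    using primitive_decomposition[OF assms(3,2)] .
  obtain i where i: "dseq \<gamma> i \<le> n" "n < dseq \<gamma> (Suc i)"
    using dseq_bracket[OF assms(1) p(2)] .
  have "scale_vec (dseq \<gamma> i) p \<in> input_vectors k M"
    using assms(3) p(3) i(1) dseq_pos[OF assms(1)] scale_vec_in_input_vectors_mono by blast
  then have "scale_vec (dseq \<gamma> i) p \<in> Cstar k M \<gamma>"
    using p(1) by (auto simp: Cstar_def multiples_code_def)
  moreover have "rounds_to k M \<gamma> x (scale_vec (dseq \<gamma> i) p)"
    unfolding rounds_to_def using p i by blast
  ultimately show ?thesis ..
qed

text \<open>The common image \<open>z\<close> determines its ray and index: its gcd is a member of
  \<open>dseq\<close>, and dividing by it recovers the primitive vector. So both factors lie in one
  gap of \<open>dseq\<close>, where ratios are at most \<open>T2 / T1\<close>.\<close>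

lemma rounds_to_same_indistinguishable:
  assumes "0 < a" and "0 < T1" and "1 \<le> T2 / T1"
    and "rounds_to k M (T2 / T1) x z" and "rounds_to k M (T2 / T1) y z"
  shows "indistinguishable k a a T1 T2 x y"
proof -
  let ?d = "dseq (T2 / T1)"
  obtain p m i where p: "p \<in> Cstar_inf k M" "x = scale_vec m p" "z = scale_vec (?d i) p"
    "?d i \<le> m" "m < ?d (Suc i)"
    using assms(4) unfolding rounds_to_def by blast
  obtain q n j where q: "q \<in> Cstar_inf k M" "y = scale_vec n q" "z = scale_vec (?d j) q"
    "?d j \<le> n" "n < ?d (Suc j)"
    using assms(5) unfolding rounds_to_def by blast
  have len: "length p = k" "length q = k"
    using p(1) q(1) by (auto simp: Cstar_inf_def input_vectors_def)
  have "Gcd (set z) = ?d i"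
    unfolding p(3) using p(1) by (simp add: Gcd_scale_vec Cstar_inf_def)
  moreover have "Gcd (set z) = ?d j"
    unfolding q(3) using q(1) by (simp add: Gcd_scale_vec Cstar_inf_def)
  ultimately have "?d i = ?d j"
    by simp
  then have ij: "i = j"
    using strict_mono_eq[OF strict_mono_dseq[OF assms(3)]] by simp
  have pos: "0 < ?d i"
    using assms(3) by (rule dseq_pos)
  have "p ! l = q ! l" if "l < k" for l
  proof -
    have "?d i * p ! l = ?d i * q ! l"
      using p(3) q(3) ij len that by (metis nth_scale_vec)
    then show ?thesis
      using pos by simp
  qed
  then have pq: "p = q"
    using len by (intro nth_equalityI) auto
  \<comment> \<open>Stated for an arbitrary ordered pair in the gap, so that it serves both orders
    of \<open>m\<close> and \<open>n\<close>.\<close>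
  have ratio: "indistinguishable k a a T1 T2 (scale_vec m' p) (scale_vec n' p)"
    if "?d i \<le> m'" "m' \<le> n'" "n' < ?d (Suc i)" for m' n'
  proof (rule indistinguishable_scale_vec)
    have "real n' \<le> T2 / T1 * real (?d i)"
      using that(3) by (rule le_mult_dseq_if_less_dseq_Suc)
    also have "\<dots> \<le> T2 / T1 * real m'"
      using that(1) assms(3) by (intro mult_left_mono) auto
    finally show "real n' \<le> T2 / T1 * real m'" .
  qed (use assms len that pos in auto)
  show ?thesis
  proof (cases "m \<le> n")
    case True
    then show ?thesis
      using ratio[of m n] p q ij pq by simp
  next
    case False
    then show ?thesis
      using ratio[of n m] p q ij pq by (simp add: indistinguishable_sym)
  qed
qed

lemma zero_error_code_card_le:
  assumes "0 < a" and "0 < T1" and "1 \<le> T2 / T1" and "k \<ge> 1"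
    and C: "zero_error_code k M a a T1 T2 C"
  shows "card C \<le> card (Cstar k M (T2 / T1))"
proof -
  have "\<forall>x\<in>C. \<exists>y. y \<in> Cstar k M (T2 / T1) \<and> rounds_to k M (T2 / T1) x y"
    using rounds_to_exists[OF assms(3,4)] C unfolding zero_error_code_def by blast
  then obtain f where f: "\<forall>x\<in>C. f x \<in> Cstar k M (T2 / T1) \<and> rounds_to k M (T2 / T1) x (f x)"
    by (rule bchoice[THEN exE])
  have "inj_on f C"
  \<comment> \<open>Two distinct codewords with the same rounding would be indistinguishable,
    against the zero-error property.\<close>
  proof (rule inj_onI, rule ccontr)
    fix x y
    assume xy: "x \<in> C" "y \<in> C" "f x = f y" "x \<noteq> y"
    then have "indistinguishable k a a T1 T2 x y"
      using f rounds_to_same_indistinguishable[OF assms(1-3)] by metis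
    then show False
      using C xy unfolding zero_error_code_def pairwise_def by blast
  qed
  moreover have "f ` C \<subseteq> Cstar k M (T2 / T1)"
    using f by blast
  \<comment> \<open>Finiteness matters because \<open>card\<close> of an infinite set is 0.\<close>
  moreover have "finite (Cstar k M (T2 / T1))"
    by (rule finite_subset[OF _ finite_input_vectors[of k M]])
      (auto simp: Cstar_def multiples_code_def)
  ultimately show ?thesis
    by (rule card_inj_on_le)
qed

theorem theorem2:
  fixes k M :: nat and a b \<xi> T1 T2 \<gamma> :: real
  assumes "k \<ge> 1" and "M \<ge> 1"
    and "0 < a" and "a \<le> b" and "\<xi> = b / a"
    and "0 < T1" and "T1 \<le> T2" and "\<gamma> = T2 / T1"
    and "\<xi> = 1" and "1 \<le> \<gamma>"
  shows "optimal_zero_error_code k M a b T1 T2 (Cstar k M \<gamma>)"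
proof -
  \<comment> \<open>Ratio 1 collapses the jitter interval to the single point
    \<open>a\<close>.\<close>
  have "b = a"
    using assms by simp
  then show ?thesis
    using assms zero_error_code_Cstar zero_error_code_card_le
    unfolding optimal_zero_error_code_def by blast
qed

end
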